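(* In a point-free relation algebra, the thins relation $\preceq$ is a partial ordering on pers; that is, on the pers of any given type $A\sim A$ it is reflexive, transitive and anti-symmetric.
   Context: A point-free relation algebra consists of the following. There is a non-empty set of basic types; each element (relation) $X$ has a type $A\sim B$ for basic types $A,B$. Monoid structure: for $X$ of type $A\sim B$ and $Y$ of type $B\sim C$ there is a composition $X\circ Y$ of type $A\sim C$; composition is associative, and for each basic type $A$ there is an identity $\mathbb{I}$ of type $A\sim A$ which is a unit of composition. Lattice structure: the relations of each type $A\sim B$ form a (finitely) distributive lattice ordered by $\subseteq$ with join $\cup$, meet $\cap$, least element $\bot$ and greatest element $\top$ (types of $\mathbb{I},\bot,\top$ are deduced from context). Factors: there are operators $\setminus$ and $/$ with $(Y\subseteq X\setminus Z)\equiv (X\circ Y\subseteq Z)\equiv (X\subseteq Z/Y)$. Converse: for each $X$ of type $A\sim B$ there is $X^{\smile}$ of type $B\sim A$, with $X^{\smile}\subseteq Y\equiv X\subseteq Y^{\smile}$, $\mathbb{I}^{\smile}=\mathbb{I}$, $(X\circ Y)^{\smile}=Y^{\smile}\circ X^{\smile}$. Modularity law: $X\circ Y\cap Z\subseteq X\circ(Y\cap X^{\smile}\circ Z)$. Complements and the cone rule are not assumed. A per is a relation $P$ (of some type $A\sim A$) with $P=P^{\smile}$ and $P\circ P\subseteq P$. For a per $P$, $\mathrm{dom}(P)=\mathbb{I}\cap P$ is its (left and right) domain. Thins: for pers $P,Q$ of the same type, $P\preceq Q$ iff $P=\mathrm{dom}(P)\circ Q\circ \mathrm{dom}(P)$ and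 $Q=Q\circ \mathrm{dom}(P)\circ Q$. *)

theory Defs
  imports "HOL-Algebra.Lattice"
begin

text \<open>
  \<open>rels R A B\<close> is the ordered set of all relations of type \<open>A \<sim> B\<close>. Composition, factors and
  converse are operations on untyped elements, constrained by the axioms only at well-typed
  arguments.
\<close>

record ('t, 'r) rel_alg =
  types :: "'t set"
  rels :: "'t \<Rightarrow> 't \<Rightarrow> 'r gorder"
  cmp :: "'r \<Rightarrow> 'r \<Rightarrow> 'r" (infixl \<open>\<bullet>\<index>\<close> 75)
  ident :: "'t \<Rightarrow> 'r"
  under :: "'r \<Rightarrow> 'r \<Rightarrow> 'r"  \<comment> \<open>\<open>under R X Z\<close> is the factor of \<open>Z\<close> with \<open>X\<close> cancelled on the left\<close>
  over :: "'r \<Rightarrow> 'r \<Rightarrow> 'r"  \<comment> \<open>\<open>over R Z Y\<close> is the factor of \<open>Z\<close> with \<open>Y\<close> cancelled on the right\<close>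
  conv :: "'r \<Rightarrow> 'r"

abbreviation hom :: "('t, 'r, 'm) rel_alg_scheme \<Rightarrow> 't \<Rightarrow> 't \<Rightarrow> 'r set" where
  "hom R A B \<equiv> carrier (rels R A B)"

locale point_free_relation_algebra =
  fixes R :: "('t, 'r, 'm) rel_alg_scheme" (structure)
  assumes types_nonempty: "types R \<noteq> {}"
    and type_unique:
      "\<lbrakk>A \<in> types R; B \<in> types R; C \<in> types R; D \<in> types R; X \<in> hom R A B; X \<in> hom R C D\<rbrakk>
        \<Longrightarrow> A = C \<and> B = D"
    \<comment> \<open>monoid structure\<close>
    and cmp_closed:
      "\<lbrakk>A \<in> types R; B \<in> types R; C \<in> types R; X \<in> hom R A B; Y \<in> hom R B C\<rbrakk>
        \<Longrightarrow> X \<bullet> Y \<in> hom R A C"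
    and cmp_assoc:
      "\<lbrakk>A \<in> types R; B \<in> types R; C \<in> types R; D \<in> types R;
        X \<in> hom R A B; Y \<in> hom R B C; Z \<in> hom R C D\<rbrakk>
        \<Longrightarrow> (X \<bullet> Y) \<bullet> Z = X \<bullet> (Y \<bullet> Z)"
    and ident_closed: "A \<in> types R \<Longrightarrow> ident R A \<in> hom R A A"
    and cmp_ident_left:
      "\<lbrakk>A \<in> types R; B \<in> types R; X \<in> hom R A B\<rbrakk> \<Longrightarrow> ident R A \<bullet> X = X"
    and cmp_ident_right:
      "\<lbrakk>A \<in> types R; B \<in> types R; X \<in> hom R A B\<rbrakk> \<Longrightarrow> X \<bullet> ident R B = X"
    \<comment> \<open>lattice structure\<close>
    and rels_bounded_lattice:
      "\<lbrakk>A \<in> types R; B \<in> types R\<rbrakk> \<Longrightarrow> bounded_lattice (rels R A B)"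
    and rels_distrib:
      "\<lbrakk>A \<in> types R; B \<in> types R; X \<in> hom R A B; Y \<in> hom R A B; Z \<in> hom R A B\<rbrakk>
        \<Longrightarrow> X \<sqinter>\<^bsub>rels R A B\<^esub> (Y \<squnion>\<^bsub>rels R A B\<^esub> Z)
          = (X \<sqinter>\<^bsub>rels R A B\<^esub> Y) \<squnion>\<^bsub>rels R A B\<^esub> (X \<sqinter>\<^bsub>rels R A B\<^esub> Z)"
    \<comment> \<open>factors\<close>
    and under_closed:
      "\<lbrakk>A \<in> types R; B \<in> types R; C \<in> types R; X \<in> hom R A B; Z \<in> hom R A C\<rbrakk>
        \<Longrightarrow> under R X Z \<in> hom R B C"
    and over_closed:
      "\<lbrakk>A \<in> types R; B \<in> types R; C \<in> types R; Z \<in> hom R A C; Y \<in> hom R B C\<rbrakk>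
        \<Longrightarrow> over R Z Y \<in> hom R A B"
    and under_iff:
      "\<lbrakk>A \<in> types R; B \<in> types R; C \<in> types R;
        X \<in> hom R A B; Y \<in> hom R B C; Z \<in> hom R A C\<rbrakk>
        \<Longrightarrow> Y \<sqsubseteq>\<^bsub>rels R B C\<^esub> under R X Z \<longleftrightarrow> X \<bullet> Y \<sqsubseteq>\<^bsub>rels R A C\<^esub> Z"
    and over_iff:
      "\<lbrakk>A \<in> types R; B \<in> types R; C \<in> types R;
        X \<in> hom R A B; Y \<in> hom R B C; Z \<in> hom R A C\<rbrakk>
        \<Longrightarrow> X \<bullet> Y \<sqsubseteq>\<^bsub>rels R A C\<^esub> Z \<longleftrightarrow> X \<sqsubseteq>\<^bsub>rels R A B\<^esub> over R Z Y"
    \<comment> \<open>converse\<close>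
    and conv_closed:
      "\<lbrakk>A \<in> types R; B \<in> types R; X \<in> hom R A B\<rbrakk> \<Longrightarrow> conv R X \<in> hom R B A"
    and conv_galois:
      "\<lbrakk>A \<in> types R; B \<in> types R; X \<in> hom R A B; Y \<in> hom R B A\<rbrakk>
        \<Longrightarrow> conv R X \<sqsubseteq>\<^bsub>rels R B A\<^esub> Y \<longleftrightarrow> X \<sqsubseteq>\<^bsub>rels R A B\<^esub> conv R Y"
    and conv_ident: "A \<in> types R \<Longrightarrow> conv R (ident R A) = ident R A"
    and conv_cmp:
      "\<lbrakk>A \<in> types R; B \<in> types R; C \<in> types R; X \<in> hom R A B; Y \<in> hom R B C\<rbrakk>
        \<Longrightarrow> conv R (X \<bullet> Y) = conv R Y \<bullet> conv R X"
    and modularity: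
      "\<lbrakk>A \<in> types R; B \<in> types R; C \<in> types R;
        X \<in> hom R A B; Y \<in> hom R B C; Z \<in> hom R A C\<rbrakk>
        \<Longrightarrow> (X \<bullet> Y) \<sqinter>\<^bsub>rels R A C\<^esub> Z
          \<sqsubseteq>\<^bsub>rels R A C\<^esub> X \<bullet> (Y \<sqinter>\<^bsub>rels R B C\<^esub> (conv R X \<bullet> Z))"

definition pers :: "('t, 'r, 'm) rel_alg_scheme \<Rightarrow> 't \<Rightarrow> 'r set" where
  "pers R A = {P \<in> hom R A A. P = conv R P \<and> P \<bullet>\<^bsub>R\<^esub> P \<sqsubseteq>\<^bsub>rels R A A\<^esub> P}"

definition per_dom :: "('t, 'r, 'm) rel_alg_scheme \<Rightarrow> 't \<Rightarrow> 'r \<Rightarrow> 'r" where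
  "per_dom R A P = ident R A \<sqinter>\<^bsub>rels R A A\<^esub> P"

text \<open>Meaningful only for \<open>P\<close> and \<open>Q\<close> in \<open>pers R A\<close>.\<close>

definition thins :: "('t, 'r, 'm) rel_alg_scheme \<Rightarrow> 't \<Rightarrow> 'r \<Rightarrow> 'r \<Rightarrow> bool" where
  "thins R A P Q \<longleftrightarrow>
     P = per_dom R A P \<bullet>\<^bsub>R\<^esub> Q \<bullet>\<^bsub>R\<^esub> per_dom R A P \<and> Q = Q \<bullet>\<^bsub>R\<^esub> per_dom R A P \<bullet>\<^bsub>R\<^esub> Q"

end

theory Submission
  imports Defs
begin

text \<open>
  Modularity gives \<open>P \<circ> dom P = P\<close> for a per \<open>P\<close>, hence \<open>P \<circ> P = P\<close> and reflexivity. Thinning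
  is contained in the inclusion order, as \<open>dom P \<subseteq> I\<close>, which gives antisymmetry. If \<open>P\<close> thins \<open>Q\<close>
  and \<open>Q\<close> thins \<open>S\<close>, then \<open>dom P\<close> is absorbed by \<open>dom Q\<close>, so \<open>P = dom P \<circ> S \<circ> dom P\<close>; moreover
  \<open>dom Q \<subseteq> Q = Q \<circ> dom P \<circ> Q \<subseteq> S \<circ> dom P \<circ> S\<close>, and composing with \<open>S\<close> on both sides gives
  \<open>S = S \<circ> dom Q \<circ> S \<subseteq> S \<circ> dom P \<circ> S\<close>.
\<close>

context point_free_relation_algebra
begin

text \<open>The two factors make composition a left adjoint in each argument, hence monotone in
  each. The arguments are changed one at a time and the inclusions chained through
  \<open>X \<bullet> Y'\<close>.\<close>

lemma cmp_mono:
  assumes types: "A \<in> types R" "B \<in> types R" "C \<in> types R"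
    and X: "X \<in> hom R A B" "X' \<in> hom R A B" "X \<sqsubseteq>\<^bsub>rels R A B\<^esub> X'"
    and Y: "Y \<in> hom R B C" "Y' \<in> hom R B C" "Y \<sqsubseteq>\<^bsub>rels R B C\<^esub> Y'"
  shows "X \<bullet> Y \<sqsubseteq>\<^bsub>rels R A C\<^esub> X' \<bullet> Y'"
proof -
  interpret AB: bounded_lattice "rels R A B" using types by (simp add: rels_bounded_lattice)
  interpret BC: bounded_lattice "rels R B C" using types by (simp add: rels_bounded_lattice)
  interpret AC: bounded_lattice "rels R A C" using types by (simp add: rels_bounded_lattice)
  have closed: "X \<bullet> Y \<in> hom R A C" "X \<bullet> Y' \<in> hom R A C" "X' \<bullet> Y' \<in> hom R A C"
    using types X Y by (auto intro: cmp_closed)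
  \<comment> \<open>Unit of the adjunction: reflexivity at \<open>X \<bullet> Y'\<close> shunted
    across \<open>under_iff\<close>.\<close>
  have "Y' \<sqsubseteq>\<^bsub>rels R B C\<^esub> under R X (X \<bullet> Y')"
    using types X Y closed by (simp add: under_iff)
  then have "Y \<sqsubseteq>\<^bsub>rels R B C\<^esub> under R X (X \<bullet> Y')"
    using types X Y closed by (blast intro: BC.le_trans under_closed)
  then have right: "X \<bullet> Y \<sqsubseteq>\<^bsub>rels R A C\<^esub> X \<bullet> Y'"
    using types X Y closed by (simp add: under_iff)
  have "X' \<sqsubseteq>\<^bsub>rels R A B\<^esub> over R (X' \<bullet> Y') Y'"
    using types X Y closed by (simp flip: over_iff)
  then have "X \<sqsubseteq>\<^bsub>rels R A B\<^esub> over R (X' \<bullet> Y') Y'"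
    using types X Y closed by (blast intro: AB.le_trans over_closed)
  then have "X \<bullet> Y' \<sqsubseteq>\<^bsub>rels R A C\<^esub> X' \<bullet> Y'"
    using types X Y closed by (simp add: over_iff)
  with right show ?thesis using closed by (blast intro: AC.le_trans)
qed

text \<open>Both inclusions are reflexivity at \<open>conv R X\<close>, read through
  \<open>conv_galois\<close> in its two directions.\<close>

lemma conv_conv:
  assumes types: "A \<in> types R" "B \<in> types R" and X: "X \<in> hom R A B"
  shows "conv R (conv R X) = X"
proof -
  interpret AB: bounded_lattice "rels R A B" using types by (simp add: rels_bounded_lattice)
  interpret BA: bounded_lattice "rels R B A" using types by (simp add: rels_bounded_lattice)
  have c: "conv R X \<in> hom R B A" "conv R (conv R X) \<in> hom R A B"
    using types X by (auto intro: conv_closed)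
  have "conv R (conv R X) \<sqsubseteq>\<^bsub>rels R A B\<^esub> X"
    using conv_galois[OF types(2,1) c(1) X] c(1) by (simp add: BA.le_refl)
  moreover have "X \<sqsubseteq>\<^bsub>rels R A B\<^esub> conv R (conv R X)"
    using conv_galois[OF types X c(1)] c(1) by (simp add: BA.le_refl)
  ultimately show ?thesis using X c by (blast intro: AB.le_antisym)
qed

lemma conv_mono:
  assumes types: "A \<in> types R" "B \<in> types R"
    and "X \<in> hom R A B" "Y \<in> hom R A B" "X \<sqsubseteq>\<^bsub>rels R A B\<^esub> Y"
  shows "conv R X \<sqsubseteq>\<^bsub>rels R B A\<^esub> conv R Y"
  using assms by (simp add: conv_galois conv_closed conv_conv)

context
  fixes A
  assumes A: "A \<in> types R"
begin

interpretation L: bounded_lattice "rels R A A"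
  using A by (simp add: rels_bounded_lattice)

abbreviation I where "I \<equiv> ident R A"
abbreviation le (infix \<open>\<lesssim>\<close> 50) where "X \<lesssim> Y \<equiv> X \<sqsubseteq>\<^bsub>rels R A A\<^esub> Y"
abbreviation H where "H \<equiv> hom R A A"
abbreviation dom where "dom \<equiv> per_dom R A"

lemmas closed = cmp_closed[OF A A A] ident_closed[OF A] conv_closed[OF A A]
lemmas assoc = cmp_assoc[OF A A A A]
lemmas mono = cmp_mono[OF A A A]
lemmas units = cmp_ident_left[OF A A] cmp_ident_right[OF A A]

lemma persD:
  assumes "P \<in> pers R A"
  shows "P \<in> H" "conv R P = P" "P \<bullet> P \<lesssim> P"
  using assms by (auto simp: pers_def)

lemma per_dom_closed: "P \<in> H \<Longrightarrow> dom P \<in> H"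
  by (simp add: per_dom_def closed)

lemma per_dom_le:
  assumes "P \<in> H"
  shows "dom P \<lesssim> I" "dom P \<lesssim> P"
  using assms by (simp_all add: per_dom_def closed L.meet_left L.meet_right)

lemma per_dom_greatest: "\<lbrakk>P \<in> H; X \<in> H; X \<lesssim> I; X \<lesssim> P\<rbrakk> \<Longrightarrow> X \<lesssim> dom P"
  by (simp add: per_dom_def closed L.meet_le)

lemma per_dom_mono:
  assumes "P \<in> H" "Q \<in> H" "P \<lesssim> Q"
  shows "dom P \<lesssim> dom Q"
  using assms
  by (meson L.le_trans per_dom_closed per_dom_greatest per_dom_le)

lemma conv_per_dom:
  assumes "P \<in> pers R A"
  shows "conv R (dom P) = dom P"
proof -
  note P = persD[OF assms]
  have d: "dom P \<in> H" using P by (simp add: per_dom_closed)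
  have "conv R (dom P) \<lesssim> I"
    using conv_mono[OF A A d closed(2) per_dom_le(1)[OF P(1)]] by (simp add: conv_ident A)
  moreover have "conv R (dom P) \<lesssim> P"
    using conv_mono[OF A A d P(1) per_dom_le(2)[OF P(1)]] P by simp
  ultimately have le: "conv R (dom P) \<lesssim> dom P"
    using P d by (simp add: per_dom_greatest closed)
  \<comment> \<open>Converse is adjoint to itself, so one inclusion yields the other.\<close>
  then have "dom P \<lesssim> conv R (dom P)"
    using A d by (simp add: conv_galois)
  with le show ?thesis using d by (simp add: L.le_antisym closed)
qed

lemma cmp_per_dom:
  assumes "P \<in> pers R A"
  shows "P \<bullet> dom P = P"
proof -
  note P = persD[OF assms]
  have d: "dom P \<in> H" using P by (simp add: per_dom_closed)
  have "P \<lesssim> P \<sqinter>\<^bsub>rels R A A\<^esub> P"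
    using P by (simp add: L.meet_le)
  \<comment> \<open>Modularity with \<open>P\<close>, \<open>I\<close>, \<open>P\<close> for its
    three relations; symmetry of \<open>P\<close> turns the inner
    \<open>conv R P \<bullet> P\<close> into \<open>P \<bullet> P\<close>, which transitivity then
    puts below \<open>P\<close>.\<close>
  then have "P \<lesssim> P \<bullet> (I \<sqinter>\<^bsub>rels R A A\<^esub> (P \<bullet> P))"
    using modularity[OF A A A P(1) closed(2) P(1)] P
    by (simp add: units) (meson L.le_trans L.meet_closed closed)
  moreover have "I \<sqinter>\<^bsub>rels R A A\<^esub> (P \<bullet> P) \<lesssim> dom P"
    using P by (meson L.le_trans L.meet_closed L.meet_left L.meet_right closed per_dom_greatest)
  ultimately have "P \<lesssim> P \<bullet> dom P"
    using P d by (meson L.le_refl L.le_trans L.meet_closed closed mono)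
  moreover have "P \<bullet> dom P \<lesssim> P"
    using mono[OF P(1) P(1) L.le_refl[OF P(1)] d closed(2) per_dom_le(1)[OF P(1)]] P
    by (simp add: units)
  ultimately show ?thesis using P d by (simp add: L.le_antisym closed)
qed

text \<open>Mirror image of \<open>cmp_per_dom\<close>: converse reverses the product and fixes both
  factors.\<close>

lemma per_dom_cmp:
  assumes "P \<in> pers R A"
  shows "dom P \<bullet> P = P"
proof -
  note P = persD[OF assms]
  have "conv R (P \<bullet> dom P) = dom P \<bullet> P"
    using P A conv_per_dom[OF assms] by (simp add: conv_cmp per_dom_closed)
  then show ?thesis using P by (simp add: cmp_per_dom[OF assms])
qed

lemma per_idem:
  assumes "P \<in> pers R A"
  shows "P \<bullet> P = P"
proof -
  note P = persD[OF assms]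
  have "P \<bullet> dom P \<lesssim> P \<bullet> P"
    using P by (simp add: mono per_dom_closed per_dom_le)
  then show ?thesis using P by (simp add: cmp_per_dom[OF assms] L.le_antisym closed)
qed

text \<open>Makes \<open>per_idem\<close> available for domains.\<close>

lemma per_dom_per:
  assumes "P \<in> pers R A"
  shows "dom P \<in> pers R A"
proof -
  note P = persD[OF assms]
  have d: "dom P \<in> H" using P by (simp add: per_dom_closed)
  have "dom P \<bullet> dom P \<lesssim> dom P"
    using mono[OF d closed(2) per_dom_le(1)[OF P(1)] d d L.le_refl[OF d]] d
    by (simp add: units)
  then show ?thesis using d by (simp add: pers_def conv_per_dom[OF assms])
qed

text \<open>Idempotence of \<open>dom P\<close> puts it below both products, since
  \<open>dom P \<lesssim> dom Q\<close>; both products lie below \<open>dom P\<close> because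
  \<open>dom Q \<lesssim> I\<close>.\<close>

lemma per_dom_absorb:
  assumes P: "P \<in> pers R A" and Q: "Q \<in> H" and "P \<lesssim> Q"
  shows "dom P \<bullet> dom Q = dom P" "dom Q \<bullet> dom P = dom P"
proof -
  note p = per_dom_closed[OF persD(1)[OF P]] and q = per_dom_closed[OF Q]
  have le: "dom P \<lesssim> dom Q" using persD[OF P] Q assms(3) by (simp add: per_dom_mono)
  have "dom P \<bullet> dom P \<lesssim> dom P \<bullet> dom Q" "dom P \<bullet> dom P \<lesssim> dom Q \<bullet> dom P"
    using p q le by (simp_all add: mono)
  then have "dom P \<lesssim> dom P \<bullet> dom Q" "dom P \<lesssim> dom Q \<bullet> dom P"
    by (simp_all add: per_idem per_dom_per P)
  moreover have "dom P \<bullet> dom Q \<lesssim> dom P"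
    using mono[OF p p L.le_refl[OF p] q closed(2) per_dom_le(1)[OF Q]] p by (simp add: units)
  moreover have "dom Q \<bullet> dom P \<lesssim> dom P"
    using mono[OF q closed(2) per_dom_le(1)[OF Q] p p L.le_refl[OF p]] p by (simp add: units)
  ultimately show "dom P \<bullet> dom Q = dom P" "dom Q \<bullet> dom P = dom P"
    using p q by (simp_all add: L.le_antisym closed)
qed

lemma thins_refl:
  assumes "P \<in> pers R A"
  shows "thins R A P P"
  by (simp add: thins_def assms cmp_per_dom per_dom_cmp per_idem)

lemma thins_le:
  assumes P: "P \<in> pers R A" and Q: "Q \<in> pers R A" and "thins R A P Q"
  shows "P \<lesssim> Q"
proof -
  note p = per_dom_closed[OF persD(1)[OF P]] and P' = persD[OF P] and Q' = persD[OF Q]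
  have "dom P \<bullet> Q \<bullet> dom P \<lesssim> I \<bullet> Q \<bullet> I"
    using P' Q' p by (simp add: mono closed per_dom_le)
  moreover have "P = dom P \<bullet> Q \<bullet> dom P" using assms by (simp add: thins_def)
  ultimately show ?thesis using Q' by (simp add: units)
qed

lemma thins_antisym:
  assumes "P \<in> pers R A" "Q \<in> pers R A" "thins R A P Q" "thins R A Q P"
  shows "P = Q"
  using assms by (simp add: thins_le L.le_antisym persD)

lemma thins_trans:
  assumes P: "P \<in> pers R A" and Q: "Q \<in> pers R A" and S: "S \<in> pers R A"
    and PQ: "thins R A P Q" and QS: "thins R A Q S"
  shows "thins R A P S"
proof -
  let ?p = "dom P" and ?q = "dom Q"
  note P' = persD[OF P] and Q' = persD[OF Q] and S' = persD[OF S]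
  note p = per_dom_closed[OF P'(1)] and q = per_dom_closed[OF Q'(1)]
  note absorb = per_dom_absorb[OF P Q'(1) thins_le[OF P Q PQ]]
  \<comment> \<open>The first equation of \<open>QS\<close> is substituted for \<open>Q\<close> in
    that of \<open>PQ\<close>.\<close>
  have "P = ?p \<bullet> (?q \<bullet> S \<bullet> ?q) \<bullet> ?p"
    using PQ QS by (simp add: thins_def)
  also have "\<dots> = (?p \<bullet> ?q) \<bullet> S \<bullet> (?q \<bullet> ?p)"
    using p q S' by (simp add: assoc closed)
  finally have 1: "P = ?p \<bullet> S \<bullet> ?p" by (simp add: absorb)
  have SpS: "S \<bullet> ?p \<bullet> S \<in> H" using S' p by (simp add: closed)
  \<comment> \<open>Both outer factors grow from \<open>Q\<close> to \<open>S\<close>; the left side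
    is \<open>Q\<close> itself by the second equation of \<open>PQ\<close>.\<close>
  have "Q \<bullet> ?p \<bullet> Q \<lesssim> S \<bullet> ?p \<bullet> S"
    using Q' S' p thins_le[OF Q S QS] by (simp add: mono closed)
  then have "Q \<lesssim> S \<bullet> ?p \<bullet> S"
    using PQ by (simp add: thins_def)
  then have "?q \<lesssim> S \<bullet> ?p \<bullet> S"
    using Q' q SpS per_dom_le(2)[OF Q'(1)] by (blast intro: L.le_trans)
  \<comment> \<open>The left side is \<open>S\<close> by the second equation of \<open>QS\<close>;
    on the right, the doubled \<open>S\<close> at each end collapses by idempotence.\<close>
  then have "S \<bullet> ?q \<bullet> S \<lesssim> S \<bullet> (S \<bullet> ?p \<bullet> S) \<bullet> S"
    using S' q SpS by (simp add: mono closed)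
  moreover have "S \<bullet> (S \<bullet> ?p \<bullet> S) \<bullet> S = (S \<bullet> S) \<bullet> ?p \<bullet> (S \<bullet> S)"
    using S' p by (simp add: assoc closed)
  moreover have "S = S \<bullet> ?q \<bullet> S" using QS by (simp add: thins_def)
  ultimately have "S \<lesssim> S \<bullet> ?p \<bullet> S" by (simp add: per_idem S)
  \<comment> \<open>Reverse inclusion: \<open>?p\<close> lies below \<open>I\<close>, and
    \<open>S\<close> is idempotent.\<close>
  moreover have "S \<bullet> ?p \<bullet> S \<lesssim> S \<bullet> I \<bullet> S"
    using S' p by (simp add: mono closed per_dom_le P')
  then have "S \<bullet> ?p \<bullet> S \<lesssim> S"
    using S' by (simp add: units per_idem S)
  ultimately have "S = S \<bullet> ?p \<bullet> S" using S' SpS by (simp add: L.le_antisym)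
  with 1 show ?thesis by (simp add: thins_def)
qed

end

end

theorem theorem9:
  fixes R :: "('t, 'r, 'm) rel_alg_scheme" and A :: 't
  assumes "point_free_relation_algebra R"
    and "A \<in> types R"
  shows "reflp_on (pers R A) (thins R A) \<and>
         transp_on (pers R A) (thins R A) \<and>
         antisymp_on (pers R A) (thins R A)"
proof -
  interpret point_free_relation_algebra R by fact
  show ?thesis
    using assms(2)
    by (auto intro!: reflp_onI transp_onI antisymp_onI
        intro: thins_refl thins_trans thins_antisym)
qed

end
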